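(* Let $k$ be a nonnegative integer and $n=2k+1$. Then $rn(C_n\square C_n)\le \frac{n^2-1}{2}(k+1)+1$.
   Context: $C_n$ is the cycle graph with vertex set $\{0,\dots,n-1\}$, distinct $v,w$ adjacent iff $v\equiv w\pm1 \pmod n$ (so $C_1$ is a single vertex). The Cartesian product $G\square H$ has vertex set $V(G)\times V(H)$, with $(g,h)\sim(g',h')$ iff ($g=g'$ and $hh'\in E(H)$) or ($h=h'$ and $gg'\in E(G)$). $d(u,v)$ is graph distance and $\operatorname{diam}(G)$ the maximum distance in $G$. A radio labeling of a connected graph $G$ is a function $c:V(G)\to\{1,2,\dots\}$ with $d(u,v)+|c(u)-c(v)|\ge 1+\operatorname{diam}(G)$ for all distinct $u,v$. The span of $c$ is its maximum value; $rn(G)$ is the minimum span over all radio labelings of $G$. *)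

theory Defs
  imports "Graph_Theory.Graph_Theory" "HOL-Number_Theory.Cong"
begin

text \<open>
  Simple graphs are the symmetric, loop-free digraphs of \<^locale>\<open>pair_graph\<close>: every edge is
  represented by the two opposite arcs.
\<close>

definition cycle_graph :: "nat \<Rightarrow> nat pair_pre_digraph" where
  "cycle_graph n = \<lparr> pverts = {0..<n},
     parcs = {(v, w). v \<in> {0..<n} \<and> w \<in> {0..<n} \<and> v \<noteq> w \<and>
       ([int v = int w + 1] (mod int n) \<or> [int v = int w - 1] (mod int n))} \<rparr>"

definition cart_prod :: "'a pair_pre_digraph \<Rightarrow> 'b pair_pre_digraph \<Rightarrow> ('a \<times> 'b) pair_pre_digraph"
    (infixl "\<box>" 70) where
  "G \<box> H = \<lparr> pverts = pverts G \<times> pverts H,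
     parcs = {((g, h), (g', h')). (g, h) \<in> pverts G \<times> pverts H \<and> (g', h') \<in> pverts G \<times> pverts H \<and>
       (g = g' \<and> (h, h') \<in> parcs H \<or> h = h' \<and> (g, g') \<in> parcs G)} \<rparr>"

text \<open>
  The library's \<^const>\<open>wf_digraph.\<mu>\<close> is a weighted distance with values in the extended reals;
  \<open>graph_dist_eq_\<mu>\<close> below relates the two. The value is meaningful only if \<open>v\<close> is reachable
  from \<open>u\<close>.
\<close>

definition graph_dist :: "'a pair_pre_digraph \<Rightarrow> 'a \<Rightarrow> 'a \<Rightarrow> nat" where
  "graph_dist G u v = (LEAST l. \<exists>p. pre_digraph.awalk (with_proj G) u p v \<and> length p = l)"

definition diam :: "'a pair_pre_digraph \<Rightarrow> nat" where
  "diam G = Max {graph_dist G u v | u v. u \<in> pverts G \<and> v \<in> pverts G}"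

text \<open>Values of a labeling outside the vertex set are irrelevant.\<close>

definition radio_labeling :: "'a pair_pre_digraph \<Rightarrow> ('a \<Rightarrow> nat) \<Rightarrow> bool" where
  "radio_labeling G c \<longleftrightarrow>
     (\<forall>v \<in> pverts G. 1 \<le> c v) \<and>
     (\<forall>u \<in> pverts G. \<forall>v \<in> pverts G. u \<noteq> v \<longrightarrow>
        int (graph_dist G u v) + \<bar>int (c u) - int (c v)\<bar> \<ge> 1 + int (diam G))"

definition labeling_span :: "'a pair_pre_digraph \<Rightarrow> ('a \<Rightarrow> nat) \<Rightarrow> nat" where
  "labeling_span G c = Max (c ` pverts G)"

text \<open>
  The minimum is attained on every finite graph (\<open>rn_attained\<close> below).
\<close>

definition rn :: "'a pair_pre_digraph \<Rightarrow> nat" where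
  "rn G = (LEAST s. \<exists>c. radio_labeling G c \<and> labeling_span G c = s)"


lemma graph_dist_eq_\<mu>:
  assumes "pair_wf_digraph G" and "u \<rightarrow>\<^sup>*\<^bsub>with_proj G\<^esub> v"
  shows "wf_digraph.\<mu> (with_proj G) (\<lambda>_. 1) u v = ereal (real (graph_dist G u v))"
proof -
  interpret pair_wf_digraph G by fact
  have cost: "awalk_cost (\<lambda>_. 1) p = real (length p)" for p :: "('a \<times> 'a) list"
    by (induction p) auto
  obtain p where "awalk u p v"
    using assms(2) reachable_awalk by auto
  then have "\<exists>l. \<exists>p. awalk u p v \<and> length p = l" by blast
  then have att: "\<exists>p. awalk u p v \<and> length p = graph_dist G u v"
    unfolding graph_dist_def by (rule LeastI_ex)
  have le: "graph_dist G u v \<le> length q" if "awalk u q v" for q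
    unfolding graph_dist_def using that by (blast intro: Least_le)
  show ?thesis
    unfolding \<mu>_def cost
  proof (rule antisym)
    obtain q where "awalk u q v" "length q = graph_dist G u v" using att by blast
    then show "(INF p\<in>{p. awalk u p v}. ereal (real (length p))) \<le> ereal (real (graph_dist G u v))"
      by (intro INF_lower2[of q]) auto
    show "ereal (real (graph_dist G u v)) \<le> (INF p\<in>{p. awalk u p v}. ereal (real (length p)))"
      using le by (intro INF_greatest) auto
  qed
qed

lemma radio_labeling_exists:
  fixes G :: "'a pair_pre_digraph"
  assumes "finite (pverts G)"
  shows "\<exists>c. radio_labeling G c"
proof -
  obtain f :: "'a \<Rightarrow> nat" where f: "inj_on f (pverts G)"
    using finite_imp_inj_to_nat_seg[OF assms] by (elim exE conjE)
  define c where "c v = 1 + (1 + diam G) * f v" for v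
  have *: "1 + int (diam G) \<le> int (graph_dist G u v) + \<bar>int (c u) - int (c v)\<bar>"
    if "u \<in> pverts G" "v \<in> pverts G" "u \<noteq> v" for u v
  proof -
    have "f u \<noteq> f v"
      using inj_onD[OF f] that by metis
    then have "1 \<le> \<bar>int (f u) - int (f v)\<bar>" by linarith
    then have "(1 + int (diam G)) * 1 \<le> (1 + int (diam G)) * \<bar>int (f u) - int (f v)\<bar>"
      by (intro mult_left_mono) simp_all
    moreover have "\<bar>int (c u) - int (c v)\<bar> = (1 + int (diam G)) * \<bar>int (f u) - int (f v)\<bar>"
    proof -
      have "int (c u) - int (c v) = (1 + int (diam G)) * (int (f u) - int (f v))"
        unfolding c_def of_nat_add of_nat_mult right_diff_distrib by simp
      then show ?thesis by (simp add: abs_mult)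
    qed
    ultimately have "1 + int (diam G) \<le> \<bar>int (c u) - int (c v)\<bar>"
      by (simp only: mult_1_right)
    then show ?thesis by linarith
  qed
  have "radio_labeling G c"
    unfolding radio_labeling_def
  proof (intro conjI ballI impI)
    show "1 \<le> c v" for v by (simp add: c_def)
  qed (rule *)
  then show ?thesis by blast
qed

lemma rn_attained:
  fixes G :: "'a pair_pre_digraph"
  assumes "finite (pverts G)"
  shows "\<exists>c. radio_labeling G c \<and> labeling_span G c = rn G"
    and "radio_labeling G c \<Longrightarrow> rn G \<le> labeling_span G c"
proof -
  have "\<exists>s c. radio_labeling G c \<and> labeling_span G c = s"
    using radio_labeling_exists[OF assms] by blast
  then show "\<exists>c. radio_labeling G c \<and> labeling_span G c = rn G"
    unfolding rn_def by (rule LeastI_ex)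
  show "rn G \<le> labeling_span G c" if "radio_labeling G c"
    unfolding rn_def using that by (blast intro: Least_le)
qed

lemma pair_graph_cycle_graph: "pair_graph (cycle_graph n)"
proof
  show "finite (parcs (cycle_graph n))"
    by (rule finite_subset[of _ "{0..<n} \<times> {0..<n}"]) (auto simp: cycle_graph_def)
  have "[int v = int w + 1] (mod int n) \<longleftrightarrow> [int w = int v - 1] (mod int n)" for v w
    using dvd_diff_commute[of "int n" "int v" "int w + 1"]
    by (simp add: cong_iff_dvd_diff algebra_simps)
  then show "symmetric (with_proj (cycle_graph n))"
    unfolding symmetric_def sym_def by (auto simp: cycle_graph_def)
qed (auto simp: cycle_graph_def)

lemma pair_graph_cart_prod:
  assumes "pair_graph G" "pair_graph H"
  shows "pair_graph (G \<box> H)"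
proof -
  interpret G: pair_graph G by fact
  interpret H: pair_graph H by fact
  have "sym (parcs G)" "sym (parcs H)"
    using G.pair_sym_arcs H.pair_sym_arcs by (auto simp: symmetric_def)
  show ?thesis
  proof
    show "finite (parcs (G \<box> H))"
      by (rule finite_subset[of _ "(pverts G \<times> pverts H) \<times> (pverts G \<times> pverts H)"])
         (auto simp: cart_prod_def)
    show "symmetric (with_proj (G \<box> H))"
      using \<open>sym (parcs G)\<close> \<open>sym (parcs H)\<close>
      unfolding symmetric_def sym_def by (auto simp: cart_prod_def)
  qed (use G.pair_no_loops H.pair_no_loops in \<open>fastforce simp: cart_prod_def\<close>)+
qed

lemma cycle_graph_reachable:
  assumes "v < n"
  shows "0 \<rightarrow>\<^sup>*\<^bsub>with_proj (cycle_graph n)\<^esub> v"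
  using assms
proof (induction v)
  interpret pair_graph "cycle_graph n" by (rule pair_graph_cycle_graph)
  case 0
  then show ?case by (intro reachable_refl) (simp add: cycle_graph_def)
next
  interpret pair_graph "cycle_graph n" by (rule pair_graph_cycle_graph)
  case (Suc v)
  have "(v, Suc v) \<in> parcs (cycle_graph n)"
    using Suc.prems by (auto simp: cycle_graph_def)
  then show ?case using Suc by (auto intro: reachable_adj_trans)
qed

lemma strongly_connected_cycle_graph:
  assumes "n > 0"
  shows "strongly_connected (with_proj (cycle_graph n))"
proof -
  interpret pair_graph "cycle_graph n" by (rule pair_graph_cycle_graph)
  show ?thesis
    unfolding strongly_connected_def
  proof (intro conjI ballI)
    show "verts (with_proj (cycle_graph n)) \<noteq> {}"
      using assms by (simp add: cycle_graph_def)
    fix u v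
    assume "u \<in> verts (with_proj (cycle_graph n))" "v \<in> verts (with_proj (cycle_graph n))"
    then have "u < n" "v < n" by (auto simp: cycle_graph_def)
    then show "u \<rightarrow>\<^sup>*\<^bsub>with_proj (cycle_graph n)\<^esub> v"
      using cycle_graph_reachable symmetric_reachable[OF pair_sym_arcs] reachable_trans by blast
  qed
qed

lemma strongly_connected_cart_prod:
  assumes "pair_graph G" "pair_graph H"
    and "strongly_connected (with_proj G)" "strongly_connected (with_proj H)"
  shows "strongly_connected (with_proj (G \<box> H))"
proof -
  interpret G: pair_graph G by fact
  interpret H: pair_graph H by fact
  interpret P: pair_graph "G \<box> H" using assms by (intro pair_graph_cart_prod)
  have 1: "(g, h) \<rightarrow>\<^sup>*\<^bsub>with_proj (G \<box> H)\<^esub> (g', h)"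
    if "g \<rightarrow>\<^sup>*\<^bsub>with_proj G\<^esub> g'" "h \<in> pverts H" for g g' h
    using that(1)
  proof (induction rule: G.reachable_induct)
    case base
    then show ?case using that(2) by (intro P.reachable_refl) (simp add: cart_prod_def)
  next
    case (step x y)
    then have "((x, h), (y, h)) \<in> parcs (G \<box> H)"
      using that(2) by (auto simp: cart_prod_def G.in_arcsD1 G.in_arcsD2)
    then show ?case using step.IH by (auto intro: P.reachable_adj_trans)
  qed
  have 2: "(g, h) \<rightarrow>\<^sup>*\<^bsub>with_proj (G \<box> H)\<^esub> (g, h')"
    if "h \<rightarrow>\<^sup>*\<^bsub>with_proj H\<^esub> h'" "g \<in> pverts G" for g h h'
    using that(1)
  proof (induction rule: H.reachable_induct)
    case base
    then show ?case using that(2) by (intro P.reachable_refl) (simp add: cart_prod_def)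
  next
    case (step x y)
    then have "((g, x), (g, y)) \<in> parcs (G \<box> H)"
      using that(2) by (auto simp: cart_prod_def H.in_arcsD1 H.in_arcsD2)
    then show ?case using step.IH by (auto intro: P.reachable_adj_trans)
  qed
  show ?thesis
    unfolding strongly_connected_def
  proof (intro conjI ballI)
    show "verts (with_proj (G \<box> H)) \<noteq> {}"
      using assms by (auto simp: strongly_connected_def cart_prod_def)
    fix x y
    assume "x \<in> verts (with_proj (G \<box> H))" "y \<in> verts (with_proj (G \<box> H))"
    then obtain g h g' h' where "x = (g, h)" "y = (g', h')"
      "g \<in> pverts G" "g' \<in> pverts G" "h \<in> pverts H" "h' \<in> pverts H"
      by (auto simp: cart_prod_def)
    moreover from this have "g \<rightarrow>\<^sup>*\<^bsub>with_proj G\<^esub> g'" "h \<rightarrow>\<^sup>*\<^bsub>with_proj H\<^esub> h'"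
      using assms by (auto simp: strongly_connected_def)
    ultimately show "x \<rightarrow>\<^sup>*\<^bsub>with_proj (G \<box> H)\<^esub> y"
      using 1 2 P.reachable_trans by blast
  qed
qed

end

theory Submission
  imports Defs
begin

text \<open>
  List the \<open>n\<^sup>2\<close> vertices in an order in which they receive labels whose successive gaps are
  alternately \<open>a\<close> and \<open>k + 1 - a\<close>. Such an order gives a radio labeling as soon as vertices one,
  two and three places apart are far enough from each other, because over four places the label
  already grows by \<open>2k + 2\<close>, which exceeds the diameter \<open>2k\<close>. It remains to find an order. Walk
  with a constant step of about \<open>(k, k/2)\<close>, which after \<open>n\<close> steps has exhausted one
  coset of a cyclic subgroup of order \<open>n\<close>, and perturb it to reach the other cosets. For odd \<open>k\<close> it is
  enough to lengthen one step in every \<open>n\<close>. For even \<open>k \<ge> 4\<close> the two gaps differ, and the cosets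
  are instead visited in pairs, alternating between the two members of a pair for \<open>2n\<close> steps, with
  a single coset left over at the end. The case \<open>k = 2\<close> needs an order of its own.
\<close>

section \<open>Distance of an integer from the multiples of \<open>n\<close>\<close>

text \<open>For \<open>n > 0\<close> this is the distance from \<open>z\<close> to the nearest
  multiple of \<open>n\<close>, hence the distance on the cycle between two vertices that differ by
  \<open>z\<close>. Taking all integers as arguments lets any representative of a vertex be
  used.\<close>

definition cyc_norm :: "nat \<Rightarrow> int \<Rightarrow> int" where
  "cyc_norm n z = min (z mod int n) (- z mod int n)"

lemma cyc_norm_nonneg: "n > 0 \<Longrightarrow> 0 \<le> cyc_norm n z"
  by (simp add: cyc_norm_def)

lemma cyc_norm_cong: "[a = b] (mod int n) \<Longrightarrow> cyc_norm n a = cyc_norm n b"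
  unfolding cyc_norm_def cong_def by (metis mod_minus_eq)

text \<open>A nonnegative integer is at least its remainder; this is applied to the representative
  \<open>z + int n * c\<close> or to its negative.\<close>

lemma cyc_norm_le:
  assumes "n > 0"
  shows "cyc_norm n z \<le> \<bar>z + int n * c\<bar>"
proof -
  have "z mod int n \<le> z + int n * c" if "0 \<le> z + int n * c"
    using that assms zmod_le_nonneg_dividend[of "z + int n * c" "int n"] by simp
  moreover have "- z mod int n \<le> - z - int n * c" if "z + int n * c \<le> 0"
  proof -
    have "(- z - int n * c) mod int n = - z mod int n"
      using mod_mult_self2[of "- z" "int n" "- c"] by simp
    then show ?thesis using zmod_le_nonneg_dividend[of "- z - int n * c" "int n"] that by simp
  qed
  ultimately show ?thesis
    unfolding cyc_norm_def by linarith
qed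

text \<open>The tool for lower bounds in the general constructions: locate \<open>z\<close> between
  the consecutive multiples with factors \<open>c\<close> and \<open>c + 1\<close>; the two
  remainders are then its distances to them.\<close>

lemma cyc_norm_ge:
  assumes "int n * c + m \<le> z" and "z \<le> int n * (c + 1) - m" and "n > 0"
  shows "m \<le> cyc_norm n z"
proof (cases "m \<le> 0")
  \<comment> \<open>Here the assumptions need not confine \<open>z\<close> to one period. Such
    \<open>m\<close> do arise: bounds in \<open>rn_torus_le_even\<close> can turn negative.\<close>
  case True
  then show ?thesis using cyc_norm_nonneg[OF assms(3)] by (rule order_trans)
next
  case False
  have "(z - int n * c) mod int n = z mod int n"
    using mod_mult_self2[of z "int n" "- c"] by simp
  moreover have "(int n * (c + 1) - z) mod int n = - z mod int n"
    using mod_mult_self2[of "- z" "int n" "c + 1"] by (simp add: add.commute)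
  moreover have "(z - int n * c) mod int n = z - int n * c"
    using assms False by (intro mod_pos_pos_trivial) (auto simp: algebra_simps)
  moreover have "(int n * (c + 1) - z) mod int n = int n * (c + 1) - z"
    using assms False by (intro mod_pos_pos_trivial) (auto simp: algebra_simps)
  ultimately show ?thesis
    using assms unfolding cyc_norm_def by linarith
qed

text \<open>The two remainders are both 0 or add up to \<open>2 * k + 1\<close>, so the smaller is
  at most \<open>k\<close>.\<close>

lemma cyc_norm_le_half:
  "cyc_norm (2 * k + 1) z \<le> int k"
proof -
  let ?n = "int (2 * k + 1)"
  have "z mod ?n < ?n" "z mod ?n \<ge> 0" by simp_all
  moreover have "- z mod ?n = (if z mod ?n = 0 then 0 else ?n - z mod ?n)"
    by (rule zmod_zminus1_eq_if)
  ultimately show ?thesis unfolding cyc_norm_def by (auto simp: min_def)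
qed

section \<open>Walks and distances in products and cycles\<close>

lemma graph_dist_le:
  "pre_digraph.awalk (with_proj G) u p v \<Longrightarrow> graph_dist G u v \<le> length p"
  unfolding graph_dist_def by (blast intro: Least_le)

lemma graph_dist_attained:
  assumes "pair_wf_digraph G" and "u \<rightarrow>\<^sup>*\<^bsub>with_proj G\<^esub> v"
  obtains p where "pre_digraph.awalk (with_proj G) u p v" "length p = graph_dist G u v"
proof -
  interpret pair_wf_digraph G by fact
  obtain p where "awalk u p v"
    using assms(2) reachable_awalk by auto
  then have "\<exists>l p. awalk u p v \<and> length p = l" by blast
  then have "\<exists>p. awalk u p v \<and> length p = graph_dist G u v"
    unfolding graph_dist_def by (rule LeastI_ex)
  then show ?thesis using that by blast
qed

text \<open>Copy \<open>p\<close> into the layer at height \<open>h\<close>, then \<open>q\<close>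
  into the layer over \<open>g'\<close>, and concatenate.\<close>

lemma graph_dist_cart_prod_le:
  assumes G: "pre_digraph.awalk (with_proj G) g p g'" and H: "pre_digraph.awalk (with_proj H) h q h'"
    and "pair_graph G" "pair_graph H"
  shows "graph_dist (G \<box> H) (g, h) (g', h') \<le> length p + length q"
proof -
  interpret G: pair_graph G by fact
  interpret H: pair_graph H by fact
  interpret P: pair_graph "G \<box> H" using assms by (intro pair_graph_cart_prod)
  have "h \<in> pverts H" "g' \<in> pverts G" using G H by auto
  have "P.awalk (g, h) (map (\<lambda>(a, b). ((a, h), (b, h))) p) (g', h)"
    using G
  proof (induction p arbitrary: g)
    case Nil
    then have "(g, h) \<in> pverts (G \<box> H)" "g = g'"
      using \<open>h \<in> pverts H\<close> by (auto simp: G.awalk_Nil_iff cart_prod_def)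
    then show ?case by (simp add: P.awalk_Nil_iff)
  next
    case (Cons e p)
    then obtain w where e: "e = (g, w)" "(g, w) \<in> parcs G" "G.awalk w p g'"
      by (cases e) (auto simp: G.awalk_Cons_iff)
    then have "((g, h), (w, h)) \<in> parcs (G \<box> H)"
      using \<open>h \<in> pverts H\<close> by (auto simp: cart_prod_def dest: G.in_arcsD1 G.in_arcsD2)
    then show ?case using Cons.IH[OF e(3)] e(1) by (simp add: P.awalk_Cons_iff)
  qed
  moreover have "P.awalk (g', h) (map (\<lambda>(a, b). ((g', a), (g', b))) q) (g', h')"
    using H
  proof (induction q arbitrary: h)
    case Nil
    then have "(g', h) \<in> pverts (G \<box> H)" "h = h'"
      using \<open>g' \<in> pverts G\<close> by (auto simp: H.awalk_Nil_iff cart_prod_def)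
    then show ?case by (simp add: P.awalk_Nil_iff)
  next
    case (Cons e p)
    then obtain w where e: "e = (h, w)" "(h, w) \<in> parcs H" "H.awalk w p h'"
      by (cases e) (auto simp: H.awalk_Cons_iff)
    then have "((g', h), (g', w)) \<in> parcs (G \<box> H)"
      using \<open>g' \<in> pverts G\<close> by (auto simp: cart_prod_def dest: H.in_arcsD1 H.in_arcsD2)
    then show ?case using Cons.IH[OF e(3)] e(1) by (simp add: P.awalk_Cons_iff)
  qed
  ultimately have "P.awalk (g, h) (map (\<lambda>(a, b). ((a, h), (b, h))) p @
      map (\<lambda>(a, b). ((g', a), (g', b))) q) (g', h')"
    by (rule P.awalk_appendI)
  from graph_dist_le[OF this] show ?thesis by simp
qed

lemma cycle_graph_awalk_ex:
  assumes "u < n" "v < n" "t < n" "e = 1 \<or> e = - 1" "[int v = int u + e * int t] (mod int n)"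
  shows "\<exists>p. pre_digraph.awalk (with_proj (cycle_graph n)) u p v \<and> length p = t"
  using assms
proof (induction t arbitrary: u)
  interpret pair_graph "cycle_graph n" by (rule pair_graph_cycle_graph)
  case 0
  then have "v = u"
    by (simp add: cong_int_iff cong_less_modulus_unique_nat)
  moreover have "u \<in> pverts (cycle_graph n)"
    using 0 by (simp add: cycle_graph_def)
  ultimately show ?case by (intro exI[of _ "[]"]) (simp add: awalk_Nil_iff)
next
  interpret pair_graph "cycle_graph n" by (rule pair_graph_cycle_graph)
  case (Suc t)
  define w where "w = nat ((int u + e) mod int n)"
  have w: "int w = (int u + e) mod int n" "w < n"
    using Suc.prems by (auto simp: w_def nat_less_iff)
  have wc: "[int w = int u + e] (mod int n)" unfolding w(1) by (simp add: cong_def)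
  have "w \<noteq> u"
  proof
    assume "w = u"
    then have "[int u = int u + e] (mod int n)" using wc by simp
    then have "int n dvd e" by (simp add: cong_iff_dvd_diff)
    \<comment> \<open>Divisibility would force \<open>n = 1\<close>, whereas
      \<open>Suc t < n\<close> gives \<open>n \<ge> 2\<close>: the one-vertex cycle has no arc to
      follow.\<close>
    then show False using Suc.prems by (auto simp: zdvd1_eq)
  qed
  moreover have "[int u = int w - e] (mod int n)"
    using cong_sym[OF cong_diff[OF wc cong_refl[of e]]] by simp
  ultimately have arc: "(u, w) \<in> parcs (cycle_graph n)"
    using Suc.prems(4) w(2) Suc.prems(1) by (auto simp: cycle_graph_def)
  have "[int u + e * int (Suc t) = int w + e * int t] (mod int n)"
    using cong_sym[OF cong_add[OF wc cong_refl[of "e * int t"]]] by (simp add: algebra_simps)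
  then have "[int v = int w + e * int t] (mod int n)"
    using Suc.prems(5) cong_trans by blast
  then obtain p where "awalk w p v" "length p = t"
    using Suc.IH[of w] Suc.prems w(2) by auto
  then show ?case using arc
    by (intro exI[of _ "(u, w) # p"]) (simp add: awalk_Cons_iff)
qed

lemma cycle_graph_awalk_cyc_norm:
  assumes "u < n" "v < n"
  shows "\<exists>p. pre_digraph.awalk (with_proj (cycle_graph n)) u p v \<and>
    int (length p) = cyc_norm n (int v - int u)"
proof -
  let ?z = "int v - int u"
  have n: "n > 0" using assms by simp
  consider "cyc_norm n ?z = ?z mod int n" | "cyc_norm n ?z = - ?z mod int n"
    unfolding cyc_norm_def by linarith
  then show ?thesis
  proof cases
    case 1
    have "[int v = int u + 1 * int (nat (?z mod int n))] (mod int n)"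
      using n by (simp add: cong_def mod_add_right_eq)
    then show ?thesis
      using cycle_graph_awalk_ex[OF assms, of "nat (?z mod int n)" 1] n 1 by (auto simp: nat_less_iff)
  next
    case 2
    have "[int v = int u + (- 1) * int (nat (- ?z mod int n))] (mod int n)"
      using n mod_diff_right_eq[of "int u" "- ?z" "int n"] by (simp add: cong_def)
    then show ?thesis
      using cycle_graph_awalk_ex[OF assms, of "nat (- ?z mod int n)" "- 1"] n 2
      by (auto simp: nat_less_iff)
  qed
qed

section \<open>Diameter and distances of the torus\<close>

abbreviation torus :: "nat \<Rightarrow> (nat \<times> nat) pair_pre_digraph" where
  "torus n \<equiv> cycle_graph n \<box> cycle_graph n"

lemma pverts_torus: "pverts (torus n) = {0..<n} \<times> {0..<n}"
  by (simp add: cart_prod_def cycle_graph_def)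

lemma pair_graph_torus: "pair_graph (torus n)"
  by (intro pair_graph_cart_prod pair_graph_cycle_graph)

text \<open>Each coordinate costs at most \<open>k\<close>. An upper bound suffices, since putting a
  larger number in place of the diameter only strengthens the radio condition.\<close>

lemma diam_torus_le: "diam (torus (2 * k + 1)) \<le> 2 * k"
proof -
  let ?n = "2 * k + 1"
  let ?D = "{graph_dist (torus ?n) u v |u v. u \<in> pverts (torus ?n) \<and> v \<in> pverts (torus ?n)}"
  have "?D \<subseteq> (\<lambda>(u, v). graph_dist (torus ?n) u v) ` (pverts (torus ?n) \<times> pverts (torus ?n))"
    by auto
  then have "finite ?D" by (rule finite_subset) (simp add: pverts_torus)
  moreover have "graph_dist (torus ?n) (0, 0) (0, 0) \<in> ?D" by (force simp: pverts_torus)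
  then have "?D \<noteq> {}" by blast
  moreover have "d \<le> 2 * k" if d: "d \<in> ?D" for d
  proof -
    obtain g h g' h' where *: "g < ?n" "h < ?n" "g' < ?n" "h' < ?n"
      and d: "d = graph_dist (torus ?n) (g, h) (g', h')"
      using d by (auto simp: pverts_torus)
    obtain p q where "pre_digraph.awalk (with_proj (cycle_graph ?n)) g p g'"
      "pre_digraph.awalk (with_proj (cycle_graph ?n)) h q h'"
      and l: "int (length p) = cyc_norm ?n (int g' - int g)" "int (length q) = cyc_norm ?n (int h' - int h)"
      using * cycle_graph_awalk_cyc_norm by meson
    then have "d \<le> length p + length q"
      unfolding d by (intro graph_dist_cart_prod_le pair_graph_cycle_graph)
    moreover have "int (length p) \<le> int k" "int (length q) \<le> int k"
      unfolding l by (rule cyc_norm_le_half)+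
    ultimately show ?thesis by simp
  qed
  ultimately show ?thesis unfolding diam_def by simp
qed

text \<open>An arc changes a single coordinate, by 1 up to a multiple of \<open>n\<close>. The
  integers \<open>c\<close> and \<open>d\<close> absorb the wrap-around, so that displacements add
  up along a walk.\<close>

lemma torus_arc_displacement:
  assumes "(u, v) \<in> parcs (torus n)"
  shows "\<exists>c d. \<bar>int (fst v) - int (fst u) + int n * c\<bar> + \<bar>int (snd v) - int (snd u) + int n * d\<bar> \<le> 1"
proof -
  have *: "\<exists>c. \<bar>int w - int v + int n * c\<bar> \<le> 1" if "(v, w) \<in> parcs (cycle_graph n)" for v w
  proof -
    have "[int w = int v - 1] (mod int n) \<or> [int w = int v + 1] (mod int n)"
    proof -
      have "[int v = int w + 1] (mod int n) \<or> [int v = int w - 1] (mod int n)"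
        using that by (auto simp: cycle_graph_def)
      then show ?thesis
        using dvd_diff_commute[of "int n" "int v" "int w + 1"] dvd_diff_commute[of "int n" "int v" "int w - 1"]
        by (auto simp: cong_iff_dvd_diff algebra_simps)
    qed
    then obtain c where "int w - int v + 1 = int n * c \<or> int w - int v - 1 = int n * c"
      by (auto simp: cong_iff_dvd_diff dvd_def algebra_simps)
    then have "\<bar>int w - int v + int n * (- c)\<bar> \<le> 1" by auto
    then show ?thesis ..
  qed
  from assms consider "fst u = fst v" "(snd u, snd v) \<in> parcs (cycle_graph n)"
    | "snd u = snd v" "(fst u, fst v) \<in> parcs (cycle_graph n)"
    by (auto simp: cart_prod_def)
  then show ?thesis
  proof cases
    case 1
    from *[OF 1(2)] obtain d where "\<bar>int (snd v) - int (snd u) + int n * d\<bar> \<le> 1" ..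
    then show ?thesis using 1(1) by (intro exI[of _ 0] exI[of _ d]) auto
  next
    case 2
    from *[OF 2(2)] obtain c where "\<bar>int (fst v) - int (fst u) + int n * c\<bar> \<le> 1" ..
    then show ?thesis using 2(1) by (intro exI[of _ c] exI[of _ 0]) auto
  qed
qed

lemma torus_awalk_displacement:
  assumes "pre_digraph.awalk (with_proj (torus n)) u p v"
  shows "\<exists>c d. \<bar>int (fst v) - int (fst u) + int n * c\<bar> + \<bar>int (snd v) - int (snd u) + int n * d\<bar>
    \<le> int (length p)"
  using assms
proof (induction p arbitrary: u)
  interpret pair_graph "torus n" by (rule pair_graph_torus)
  case Nil
  then have "u = v" by (simp add: awalk_Nil_iff)
  then show ?case by (intro exI[of _ 0]) simp
next
  interpret pair_graph "torus n" by (rule pair_graph_torus)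
  case (Cons e p)
  then obtain w where e: "e = (u, w)" "(u, w) \<in> parcs (torus n)" and p: "awalk w p v"
    by (cases e) (auto simp: awalk_Cons_iff)
  obtain c d where 1: "\<bar>int (fst w) - int (fst u) + int n * c\<bar> + \<bar>int (snd w) - int (snd u) + int n * d\<bar> \<le> 1"
    using torus_arc_displacement[OF e(2)] by blast
  obtain c' d' where 2: "\<bar>int (fst v) - int (fst w) + int n * c'\<bar> + \<bar>int (snd v) - int (snd w) + int n * d'\<bar>
    \<le> int (length p)"
    using Cons.IH[OF p] by blast
  have "\<bar>int (fst v) - int (fst u) + int n * (c + c')\<bar> + \<bar>int (snd v) - int (snd u) + int n * (d + d')\<bar>
    \<le> int (length (e # p))"
    using 1 2 unfolding distrib_left by simp
  then show ?case by blast
qed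

text \<open>The total displacement along a shortest walk is a representative of the coordinate
  differences, and \<open>cyc_norm\<close> is minimal among the absolute values of
  representatives.\<close>

lemma torus_dist_ge:
  assumes "u \<in> pverts (torus n)" "v \<in> pverts (torus n)"
  shows "cyc_norm n (int (fst v) - int (fst u)) + cyc_norm n (int (snd v) - int (snd u))
    \<le> int (graph_dist (torus n) u v)"
proof -
  have n: "n > 0" using assms by (auto simp: pverts_torus)
  interpret pair_graph "torus n" by (rule pair_graph_torus)
  have "strongly_connected (with_proj (torus n))"
    by (intro strongly_connected_cart_prod pair_graph_cycle_graph strongly_connected_cycle_graph n)
  then have "u \<rightarrow>\<^sup>*\<^bsub>with_proj (torus n)\<^esub> v"
    using assms by (simp add: strongly_connected_def)
  then obtain p where p: "awalk u p v" "length p = graph_dist (torus n) u v"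
    using graph_dist_attained[OF pair_wf_digraph_axioms] by blast
  then obtain c d where "\<bar>int (fst v) - int (fst u) + int n * c\<bar> + \<bar>int (snd v) - int (snd u) + int n * d\<bar>
    \<le> int (graph_dist (torus n) u v)"
    using torus_awalk_displacement by metis
  then show ?thesis
    using cyc_norm_le[OF n, of "int (fst v) - int (fst u)" c]
      cyc_norm_le[OF n, of "int (snd v) - int (snd u)" d] by linarith
qed

lemma cyc_norm_minus: "cyc_norm n (- z) = cyc_norm n z"
  by (simp add: cyc_norm_def min.commute)

lemma cyc_norm_diff_commute: "cyc_norm n (a - b) = cyc_norm n (b - a)"
  using cyc_norm_minus[of n "a - b"] by simp

section \<open>From an ordering of the vertices to a radio labeling\<close>

text \<open>The \<open>i\<close>-th vertex is \<open>(X i, Y i)\<close> modulo \<open>n\<close>.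
  Labels one, two or three places apart differ by \<open>a\<close> or \<open>k + 1 - a\<close>, by
  \<open>k + 1\<close>, and by \<open>k + 1 + a\<close> or \<open>2 * k + 2 - a\<close>; the
  distance hypotheses are exactly what is missing to \<open>2 * k + 1\<close>.\<close>

lemma rn_torus_le_if_ordering:
  fixes X Y :: "nat \<Rightarrow> int" and k n a :: nat
  defines "dst \<equiv> \<lambda>i j. cyc_norm n (X j - X i) + cyc_norm n (Y j - Y i)"
  assumes n: "n = 2 * k + 1" and a: "a \<le> k + 1"
    and inj: "inj_on (\<lambda>i. (X i mod int n, Y i mod int n)) {..<n * n}"
    and d1: "\<And>i. i + 1 < n * n \<Longrightarrow> even i \<Longrightarrow> 2 * int k + 1 - int a \<le> dst i (i + 1)"
      "\<And>i. i + 1 < n * n \<Longrightarrow> odd i \<Longrightarrow> int k + int a \<le> dst i (i + 1)"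
    and d2: "\<And>i. i + 2 < n * n \<Longrightarrow> int k \<le> dst i (i + 2)"
    and d3: "\<And>i. i + 3 < n * n \<Longrightarrow> even i \<Longrightarrow> int k - int a \<le> dst i (i + 3)"
      "\<And>i. i + 3 < n * n \<Longrightarrow> odd i \<Longrightarrow> int a - 1 \<le> dst i (i + 3)"
  shows "rn (torus n) \<le> 1 + (k + 1) * (n * n div 2)"
proof -
  define pos where "pos i = (nat (X i mod int n), nat (Y i mod int n))" for i
  define L where "L i = 1 + (k + 1) * (i div 2) + (if odd i then a else 0)" for i :: nat
  have n0: "n > 0" using n by simp
  have pos: "int (fst (pos i)) = X i mod int n" "int (snd (pos i)) = Y i mod int n" for i
    using n0 by (simp_all add: pos_def)
  have "inj_on pos {..<n * n}"
  proof (rule inj_onI)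
    fix i j assume "i \<in> {..<n * n}" "j \<in> {..<n * n}" and eq: "pos i = pos j"
    moreover have "(X i mod int n, Y i mod int n) = (X j mod int n, Y j mod int n)"
      unfolding pos[symmetric] eq ..
    ultimately show "i = j" using inj by (auto dest: inj_onD)
  qed
  moreover have "pos ` {..<n * n} \<subseteq> pverts (torus n)"
    using n0 by (auto simp: pos_def pverts_torus nat_less_iff)
  \<comment> \<open>An injection of \<open>n * n\<close> indices into \<open>n * n\<close> vertices
    is onto.\<close>
  ultimately have bij: "bij_betw pos {..<n * n} (pverts (torus n))"
    unfolding bij_betw_def using card_subset_eq[of "pverts (torus n)" "pos ` {..<n * n}"]
    by (simp add: pverts_torus card_image)
  define idx where "idx = the_inv_into {..<n * n} pos"
  have idx: "idx (pos i) = i" if "i < n * n" for i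
    unfolding idx_def using that bij by (intro the_inv_into_f_f) (auto simp: bij_betw_def)
  have dist: "dst i j \<le> int (graph_dist (torus n) (pos i) (pos j))"
    "dst i j \<le> int (graph_dist (torus n) (pos j) (pos i))" if "i < n * n" "j < n * n" for i j
  proof -
    have V: "pos i \<in> pverts (torus n)" "pos j \<in> pverts (torus n)"
      using that bij by (auto simp: bij_betw_def)
    have e: "dst i j = cyc_norm n (int (fst (pos j)) - int (fst (pos i))) +
        cyc_norm n (int (snd (pos j)) - int (snd (pos i)))" for i j
      unfolding dst_def pos by (intro arg_cong2[where f="(+)"] cyc_norm_cong) (simp_all add: cong_def mod_diff_eq)
    show "dst i j \<le> int (graph_dist (torus n) (pos i) (pos j))"
      unfolding e using torus_dist_ge[OF V] .
    have "dst i j = dst j i" unfolding dst_def by (metis cyc_norm_diff_commute)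
    then show "dst i j \<le> int (graph_dist (torus n) (pos j) (pos i))"
      unfolding e using torus_dist_ge[OF V(2,1)] by simp
  qed
  have dst0: "0 \<le> dst i j" for i j
    unfolding dst_def using cyc_norm_nonneg[OF n0] by (simp add: add_nonneg_nonneg)
  have gap: "1 + 2 * int k \<le> dst i j + (int (L j) - int (L i))" if "i < j" "j < n * n" for i j
  proof -
    consider "j = i + 1" | "j = i + 2" | "j = i + 3" | "j \<ge> i + 4" using \<open>i < j\<close> by linarith
    then show ?thesis
    proof cases
      case 1
      have "int (L (i + 1)) - int (L i) = (if even i then int a else int k + 1 - int a)"
        by (auto simp: L_def algebra_simps elim!: evenE oddE)
      then show ?thesis using d1[of i] that 1 by (auto split: if_splits)
    next
      case 2
      have "int (L (i + 2)) - int (L i) = int k + 1"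
        by (auto simp: L_def algebra_simps)
      then show ?thesis using d2[of i] that 2 by auto
    next
      case 3
      have "int (L (i + 3)) - int (L i) = int k + 1 + (if even i then int a else int k + 1 - int a)"
        by (auto simp: L_def algebra_simps numeral_3_eq_3 elim!: evenE oddE)
      then show ?thesis using d3[of i] that 3 by (auto split: if_splits)
    next
      case 4
      have "j div 2 \<ge> i div 2 + 2" using 4 div_le_mono[of "i + 4" j 2] by simp
      then have le: "(k + 1) * (j div 2) \<ge> (k + 1) * (i div 2 + 2)"
        by (rule mult_left_mono) simp
      have "L i + 2 * k + 1 \<le> L j"
      proof (cases "odd i \<and> even j")
        \<comment> \<open>Now \<open>a\<close> counts in \<open>L i\<close> but not in
          \<open>L j\<close>. Parity gives \<open>j \<ge> i + 5\<close>, and the additional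
          \<open>k + 1 \<ge> a\<close> makes up for the loss.\<close>
        case True
        then have "j div 2 \<ge> i div 2 + 3" using 4 by (auto elim!: evenE oddE)
        then have "(k + 1) * (j div 2) \<ge> (k + 1) * (i div 2 + 3)"
          by (rule mult_left_mono) simp
        moreover have "(k + 1) * (i div 2 + 3) = (k + 1) * (i div 2) + 3 * k + 3"
          by (simp add: algebra_simps)
        ultimately show ?thesis using True a by (simp add: L_def)
      next
        case False
        then show ?thesis using le by (auto simp: L_def)
      qed
      then show ?thesis using dst0[of i j] by linarith
    qed
  qed
  have "radio_labeling (torus n) (\<lambda>v. L (idx v))"
    unfolding radio_labeling_def
  proof (intro conjI ballI impI)
    fix v show "1 \<le> L (idx v)" by (simp add: L_def)
  next
    fix u v assume "u \<in> pverts (torus n)" "v \<in> pverts (torus n)" "u \<noteq> v"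
    moreover from this have "u \<in> pos ` {..<n * n}" "v \<in> pos ` {..<n * n}"
      unfolding bij_betw_imp_surj_on[OF bij] by simp_all
    then obtain i j where "i < n * n" "j < n * n" "u = pos i" "v = pos j" by blast
    ultimately have ij: "i < n * n" "j < n * n" "u = pos i" "v = pos j" "i \<noteq> j" by auto
    have "diam (torus n) \<le> 2 * k" using diam_torus_le n by simp
    then show "1 + int (diam (torus n)) \<le>
        int (graph_dist (torus n) u v) + \<bar>int (L (idx u)) - int (L (idx v))\<bar>"
      using gap[of i j] gap[of j i] dist[of i j] dist[of j i] ij(1,2,5)
      unfolding ij(3,4) idx[OF ij(1)] idx[OF ij(2)] by linarith
  qed
  then have "rn (torus n) \<le> labeling_span (torus n) (\<lambda>v. L (idx v))"
    by (intro rn_attained(2)) (simp add: pverts_torus)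
  also have "\<dots> \<le> 1 + (k + 1) * (n * n div 2)"
    unfolding labeling_span_def
  proof (rule Max.boundedI)
    fix l assume "l \<in> (\<lambda>v. L (idx v)) ` pverts (torus n)"
    then have "l \<in> (\<lambda>v. L (idx v)) ` pos ` {..<n * n}"
      unfolding bij_betw_imp_surj_on[OF bij] .
    then obtain i where i: "i < n * n" "l = L i"
      using idx by auto
    \<comment> \<open>The last index is even and equals \<open>2 * m\<close>, so its label is the
      claimed bound. An odd index lies below it, which leaves room for
      \<open>a \<le> k + 1\<close>.\<close>
    have "odd (n * n)" using n by simp
    then obtain m where m: "n * n = 2 * m + 1" by (rule oddE)
    show "l \<le> 1 + (k + 1) * (n * n div 2)"
    proof (cases "odd i")
      case True
      then have "i div 2 + 1 \<le> m" using i m by (auto elim!: oddE)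
      then have "(k + 1) * (i div 2 + 1) \<le> (k + 1) * m" by (rule mult_left_mono) simp
      then show ?thesis using a m True i by (simp add: L_def)
    next
      case False
      then have "i div 2 \<le> m" using i m by auto
      then have "(k + 1) * (i div 2) \<le> (k + 1) * m" by (rule mult_left_mono) simp
      then show ?thesis using m False i by (simp add: L_def)
    qed
  qed (use n0 in \<open>auto simp: pverts_torus\<close>)
  finally show ?thesis .
qed

section \<open>Ordering for odd \<open>k\<close>\<close>

lemma div_add_le_Suc_div:
  fixes i n t :: nat
  assumes "t \<le> n" "n > 0"
  shows "(i + t) div n \<le> i div n + 1"
  using div_le_mono[of "i + t" "i + n" n] assms by simp

lemma eq_if_cong_less:
  fixes i j n :: nat
  assumes "[int i = int j] (mod int n)" "i < n" "j < n"
  shows "i = j"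
  using assms by (simp add: cong_int_iff cong_less_modulus_unique_nat)

text \<open>Both gaps equal \<open>h + 1\<close>, half of \<open>k + 1\<close>, so neighbours must
  be at distance \<open>3 * h + 2\<close>. This is the length of the step
  \<open>(k, h + 1)\<close>.\<close>

lemma rn_torus_le_odd:
  fixes h k n :: nat
  assumes k: "k = 2 * h + 1" and n: "n = 2 * k + 1"
  shows "rn (torus n) \<le> 1 + (k + 1) * (n * n div 2)"
proof -
  define X where "X i = int k * int i" for i
  define Y where "Y i = (int h + 1) * int i + int (i div n)" for i
  have n': "n = 4 * h + 3" using k n by simp
  have nz: "int n = 4 * int h + 3" "int k = 2 * int h + 1" using n' k by simp_all
  have n0: "n > 0" using n by simp
  have X: "X (i + t) - X i = int t * int k" for i t
    by (simp add: X_def algebra_simps)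
  have Y: "Y (i + t) - Y i = int t * (int h + 1) + (int ((i + t) div n) - int (i div n))" for i t
    by (simp add: Y_def algebra_simps)
  \<comment> \<open>Within \<open>n\<close> places the extra unit in \<open>Y\<close> is added at
    most once.\<close>
  have div: "int (i div n) \<le> int ((i + t) div n)" "int ((i + t) div n) \<le> int (i div n) + 1" if "t \<le> n" for i t
    using div_le_mono[of i "i + t" n] div_add_le_Suc_div[OF that n0, of i] by simp_all
  have s1: "3 * int h + 2 \<le> cyc_norm n (X (i + 1) - X i) + cyc_norm n (Y (i + 1) - Y i)" for i
  proof -
    have "int k \<le> cyc_norm n (X (i + 1) - X i)"
      unfolding X using nz n0 by (intro cyc_norm_ge[of _ 0]) auto
    moreover have "int h + 1 \<le> cyc_norm n (Y (i + 1) - Y i)"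
      unfolding Y using nz n0 div[of 1 i] n' by (intro cyc_norm_ge[of _ 0]) auto
    ultimately show ?thesis using nz by linarith
  qed
  have s2: "int k \<le> cyc_norm n (X (i + 2) - X i) + cyc_norm n (Y (i + 2) - Y i)" for i
  proof -
    \<comment> \<open>\<open>2 * k\<close> is \<open>n - 1\<close>, one short of a multiple of
      \<open>n\<close>. In \<open>Y\<close>, two steps end \<open>2 * h + 1\<close> before
      \<open>n\<close>, or \<open>2 * h\<close> if the extra unit falls among them.\<close>
    have "1 \<le> cyc_norm n (X (i + 2) - X i)"
      unfolding X using nz n0 by (intro cyc_norm_ge[of _ 0]) auto
    moreover have "2 * int h \<le> cyc_norm n (Y (i + 2) - Y i)"
      unfolding Y using nz n0 div[of 2 i] n' by (intro cyc_norm_ge[of _ 0]) auto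
    ultimately show ?thesis using nz by linarith
  qed
  have s3: "int h \<le> cyc_norm n (X (i + 3) - X i) + cyc_norm n (Y (i + 3) - Y i)" for i
  proof -
    \<comment> \<open>\<open>3 * k = n + 2 * h\<close>: three steps pass one multiple of
      \<open>n\<close>, hence the witness 1.\<close>
    have "2 * int h \<le> cyc_norm n (X (i + 3) - X i)"
      unfolding X using nz n0 by (intro cyc_norm_ge[of _ 1]) auto
    then show ?thesis using cyc_norm_nonneg[OF n0, of "Y (i + 3) - Y i"] by linarith
  qed
  have inj: "inj_on (\<lambda>i. (X i mod int n, Y i mod int n)) {..<n * n}"
  proof (rule inj_onI)
    fix i j assume "i \<in> {..<n * n}" "j \<in> {..<n * n}"
      and "(X i mod int n, Y i mod int n) = (X j mod int n, Y j mod int n)"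
    then have ij: "i div n < n" "j div n < n"
      and c: "[X i = X j] (mod int n)" "[Y i = Y j] (mod int n)"
      by (auto simp: cong_def less_mult_imp_div_less)
    have "coprime (int k) (int n)"
    proof -
      have "int n - 2 * int k = 1" using n by simp
      then show ?thesis by (metis coprime_def dvd_diff dvd_mult)
    qed
    \<comment> \<open>\<open>X\<close> recovers \<open>i\<close> modulo \<open>n\<close>;
      subtracting the linear part of \<open>Y\<close> then leaves \<open>i div n\<close>.\<close>
    then have m: "[int i = int j] (mod int n)"
      using c(1) by (simp add: X_def cong_mult_lcancel)
    then have "[(int h + 1) * int i = (int h + 1) * int j] (mod int n)"
      by (rule cong_scalar_left)
    from cong_diff[OF c(2) this] have "[int (i div n) = int (j div n)] (mod int n)"
      by (simp add: Y_def)
    then have "i div n = j div n" using ij by (rule eq_if_cong_less)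
    moreover have "i mod n = j mod n" using m by (metis cong_def cong_int_iff)
    ultimately show "i = j" by (metis div_mult_mod_eq)
  qed
  show ?thesis
  proof (rule rn_torus_le_if_ordering[where a = "h + 1" and X = X and Y = Y, OF n _ inj])
    fix i
    show "2 * int k + 1 - int (h + 1) \<le> cyc_norm n (X (i + 1) - X i) + cyc_norm n (Y (i + 1) - Y i)"
      and "int k + int (h + 1) \<le> cyc_norm n (X (i + 1) - X i) + cyc_norm n (Y (i + 1) - Y i)"
      using s1[of i] nz by linarith+
    show "int k - int (h + 1) \<le> cyc_norm n (X (i + 3) - X i) + cyc_norm n (Y (i + 3) - Y i)"
      and "int (h + 1) - 1 \<le> cyc_norm n (X (i + 3) - X i) + cyc_norm n (Y (i + 3) - Y i)"
      using s3[of i] nz by linarith+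
  qed (use s2 k in auto)
qed

section \<open>Ordering for even \<open>k\<close> from 4 on\<close>

text \<open>The gaps are \<open>h\<close> and \<open>h + 1\<close>. The coset index enters
  \<open>X\<close> and \<open>Y\<close> with opposite signs, so a change of coset mostly trades
  distance between the two coordinates.\<close>

lemma rn_torus_le_even:
  fixes h k n :: nat
  assumes h: "h \<ge> 2" and k: "k = 2 * h" and n: "n = 2 * k + 1"
  shows "rn (torus n) \<le> 1 + (k + 1) * (n * n div 2)"
proof -
  \<comment> \<open>\<open>R i\<close> is the index of the coset of \<open>\<langle>(k, h + 1)\<rangle>\<close> containing the \<open>i\<close>-th vertex.\<close>
  define R where "R i = min (2 * k) (i mod 2 + 2 * (i div 2 div n))" for i
  define X where "X i = int k * int i - int (R i)" for i
  define Y where "Y i = (int h + 1) * int i + int (R i)" for i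
  have nz: "int n = 4 * int h + 1" "int k = 2 * int h" "int h \<ge> 2" using n k h by simp_all
  have n0: "n > 0" "n \<ge> 2" using n k h by simp_all
  have X: "X (i + t) - X i = int t * int k - (int (R (i + t)) - int (R i))" for i t
    by (simp add: X_def algebra_simps)
  have Y: "Y (i + t) - Y i = int t * (int h + 1) + (int (R (i + t)) - int (R i))" for i t
    by (simp add: Y_def algebra_simps)
  have R1: "\<bar>int (R (i + 1)) - int (R i)\<bar> \<le> 1"
    and R1e: "even i \<Longrightarrow> R i \<le> R (i + 1)"
    and R2: "R i \<le> R (i + 2)" "R (i + 2) \<le> R i + 2"
    and R3e: "even i \<Longrightarrow> R i \<le> R (i + 3)" "even i \<Longrightarrow> R (i + 3) \<le> R i + 3"
    and R3o: "odd i \<Longrightarrow> \<bar>int (R (i + 3)) - int (R i)\<bar> \<le> 1" for i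
  proof -
    \<comment> \<open>Indices \<open>i\<close> to \<open>i + 3\<close> only involve the pair numbers
      \<open>d0\<close>, \<open>d1\<close>, \<open>d2\<close>, and these increase at most once
      because \<open>n \<ge> 2\<close>.\<close>
    define j where "j = i div 2"
    define d0 d1 d2 where d: "d0 = j div n" "d1 = (j + 1) div n" "d2 = (j + 2) div n"
    have le: "d0 \<le> d1" "d1 \<le> d2" "d1 \<le> d0 + 1" "d2 \<le> d0 + 1"
      unfolding d using n0 by (simp_all only: div_le_mono div_add_le_Suc_div add_left_mono le_add1 one_le_numeral)
    have cases: "d1 = d0 \<or> d1 = d0 + 1" "d2 = d0 \<or> d2 = d0 + 1" using le by linarith+
    have Re: "R (2 * m) = min (2 * k) (2 * (m div n))" and Ro: "R (2 * m + 1) = min (2 * k) (1 + 2 * (m div n))" for m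
      by (simp_all add: R_def)
    have ev: "R i = min (2 * k) (2 * d0)" "R (i + 1) = min (2 * k) (1 + 2 * d0)"
      "R (i + 2) = min (2 * k) (2 * d1)" "R (i + 3) = min (2 * k) (1 + 2 * d1)" if "even i"
    proof -
      have i: "i = 2 * j" using that by (simp add: j_def)
      have *: "i + 2 = 2 * (j + 1)" "i + 3 = 2 * (j + 1) + 1" using i by simp_all
      show "R i = min (2 * k) (2 * d0)" "R (i + 1) = min (2 * k) (1 + 2 * d0)"
        unfolding i Re Ro d by simp_all
      show "R (i + 2) = min (2 * k) (2 * d1)" "R (i + 3) = min (2 * k) (1 + 2 * d1)"
        unfolding * Re Ro d by simp_all
    qed
    have od: "R i = min (2 * k) (1 + 2 * d0)" "R (i + 1) = min (2 * k) (2 * d1)"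
      "R (i + 2) = min (2 * k) (1 + 2 * d1)" "R (i + 3) = min (2 * k) (2 * d2)" if "odd i"
    proof -
      have i: "i = 2 * j + 1" using that by (simp add: j_def)
      have *: "i + 1 = 2 * (j + 1)" "i + 2 = 2 * (j + 1) + 1" "i + 3 = 2 * (j + 2)" using i by simp_all
      show "R i = min (2 * k) (1 + 2 * d0)"
        unfolding i Ro d by simp
      show "R (i + 1) = min (2 * k) (2 * d1)"
        "R (i + 2) = min (2 * k) (1 + 2 * d1)" "R (i + 3) = min (2 * k) (2 * d2)"
        unfolding * Re Ro d by simp_all
    qed
    show "even i \<Longrightarrow> R i \<le> R (i + 1)"
      "even i \<Longrightarrow> R i \<le> R (i + 3)" "even i \<Longrightarrow> R (i + 3) \<le> R i + 3"
      using ev le by auto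
    show "odd i \<Longrightarrow> \<bar>int (R (i + 3)) - int (R i)\<bar> \<le> 1"
      using od cases(2) by (auto simp: min_def)
    have "\<bar>int (R (i + 1)) - int (R i)\<bar> \<le> 1 \<and> R i \<le> R (i + 2) \<and> R (i + 2) \<le> R i + 2"
    proof (cases "even i")
      case True
      show ?thesis unfolding ev[OF True] using cases(1) by (auto simp: min_def)
    next
      case False
      show ?thesis unfolding od[OF False] using cases(1) by (auto simp: min_def; arith)
    qed
    then show "\<bar>int (R (i + 1)) - int (R i)\<bar> \<le> 1" "R i \<le> R (i + 2)" "R (i + 2) \<le> R i + 2"
      by blast+
  qed
  have s1e: "3 * int h + 1 \<le> cyc_norm n (X (i + 1) - X i) + cyc_norm n (Y (i + 1) - Y i)" if "even i" for i
  proof -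
    define \<rho> where "\<rho> = int (R (i + 1)) - int (R i)"
    have r: "0 \<le> \<rho>" "\<rho> \<le> 1" using R1[of i] R1e[OF that] unfolding \<rho>_def by linarith+
    have "int k - \<rho> \<le> cyc_norm n (X (i + 1) - X i)"
      unfolding X \<rho>_def[symmetric] using nz n0 r by (intro cyc_norm_ge[of _ 0]) auto
    \<comment> \<open>The \<open>Y\<close> step can be \<open>h + 2\<close>, which has to stay below
      half of \<open>n = 4 * h + 1\<close>; this uses \<open>h \<ge> 2\<close>.\<close>
    moreover have "int h + 1 + \<rho> \<le> cyc_norm n (Y (i + 1) - Y i)"
      unfolding Y \<rho>_def[symmetric] using nz n0 r by (intro cyc_norm_ge[of _ 0]) auto
    ultimately show ?thesis using nz by linarith
  qed
  have s1o: "3 * int h \<le> cyc_norm n (X (i + 1) - X i) + cyc_norm n (Y (i + 1) - Y i)" for i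
  proof -
    define \<rho> where "\<rho> = int (R (i + 1)) - int (R i)"
    have r: "- 1 \<le> \<rho>" "\<rho> \<le> 1" using R1[of i] unfolding \<rho>_def by linarith+
    \<comment> \<open>For \<open>\<rho> = - 1\<close> the \<open>X\<close> step is
      \<open>k + 1 = n - k\<close>, still at distance \<open>k\<close>, while \<open>Y\<close> loses
      a unit. The larger gap \<open>h + 1\<close> after odd indices pays for it.\<close>
    have "int k - max 0 \<rho> \<le> cyc_norm n (X (i + 1) - X i)"
      unfolding X \<rho>_def[symmetric] using nz n0 r by (intro cyc_norm_ge[of _ 0]) auto
    moreover have "int h + 1 + \<rho> \<le> cyc_norm n (Y (i + 1) - Y i)"
      unfolding Y \<rho>_def[symmetric] using nz n0 r by (intro cyc_norm_ge[of _ 0]) auto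
    ultimately show ?thesis using nz r by linarith
  qed
  have s2: "int k \<le> cyc_norm n (X (i + 2) - X i) + cyc_norm n (Y (i + 2) - Y i)" for i
  proof -
    define \<rho> where "\<rho> = int (R (i + 2)) - int (R i)"
    have r: "0 \<le> \<rho>" "\<rho> \<le> 2" using R2[of i] unfolding \<rho>_def by linarith+
    \<comment> \<open>Two steps end \<open>1 + \<rho>\<close> before \<open>n\<close> in
      \<open>X\<close> and \<open>k - 1 - \<rho>\<close> before \<open>n\<close> in
      \<open>Y\<close>, so \<open>\<rho>\<close> cancels in the sum.\<close>
    have "1 + \<rho> \<le> cyc_norm n (X (i + 2) - X i)"
      unfolding X \<rho>_def[symmetric] using nz n0 r by (intro cyc_norm_ge[of _ 0]) auto
    moreover have "int k - 1 - \<rho> \<le> cyc_norm n (Y (i + 2) - Y i)"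
      unfolding Y \<rho>_def[symmetric] using nz n0 r by (intro cyc_norm_ge[of _ 0]) auto
    ultimately show ?thesis by linarith
  qed
  have s3e: "int h \<le> cyc_norm n (X (i + 3) - X i) + cyc_norm n (Y (i + 3) - Y i)" if "even i" for i
  proof -
    define \<rho> where "\<rho> = int (R (i + 3)) - int (R i)"
    have r: "0 \<le> \<rho>" "\<rho> \<le> 3" using R3e[OF that] unfolding \<rho>_def by linarith+
    have x: "int k - 1 - \<rho> \<le> cyc_norm n (X (i + 3) - X i)"
      unfolding X \<rho>_def[symmetric] using nz n0 r by (intro cyc_norm_ge[of _ 1]) auto
    \<comment> \<open>The \<open>Y\<close> displacement \<open>3 * h + 3 + \<rho>\<close> may fall
      on either side of \<open>n\<close>, so both windows are used. If
      \<open>\<rho> > h - 1\<close>, the bound \<open>x\<close> alone is below \<open>h\<close> and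
      the second window supplies the missing \<open>\<rho> + 2 - h\<close>.\<close>
    have "min (3 * int h + 3 + \<rho>) (int h - 2 - \<rho>) \<le> cyc_norm n (Y (i + 3) - Y i)"
      unfolding Y \<rho>_def[symmetric] using nz n0 r by (intro cyc_norm_ge[of _ 0]) auto
    moreover have "\<rho> + 2 - int h \<le> cyc_norm n (Y (i + 3) - Y i)"
      unfolding Y \<rho>_def[symmetric] using nz n0 r by (intro cyc_norm_ge[of _ 1]) auto
    ultimately show ?thesis using nz x r cyc_norm_nonneg[OF n0(1), of "Y (i + 3) - Y i"] by linarith
  qed
  have s3o: "int h - 1 \<le> cyc_norm n (X (i + 3) - X i) + cyc_norm n (Y (i + 3) - Y i)" if "odd i" for i
  proof -
    define \<rho> where "\<rho> = int (R (i + 3)) - int (R i)"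
    have r: "- 1 \<le> \<rho>" "\<rho> \<le> 1" using R3o[OF that] unfolding \<rho>_def by linarith+
    have "int k - 2 \<le> cyc_norm n (X (i + 3) - X i)"
      unfolding X \<rho>_def[symmetric] using nz n0 r by (intro cyc_norm_ge[of _ 1]) auto
    then show ?thesis using nz cyc_norm_nonneg[OF n0(1), of "Y (i + 3) - Y i"] by linarith
  qed
  have inj: "inj_on (\<lambda>i. (X i mod int n, Y i mod int n)) {..<n * n}"
  proof (rule inj_onI)
    fix i j assume ij: "i \<in> {..<n * n}" "j \<in> {..<n * n}"
      and "(X i mod int n, Y i mod int n) = (X j mod int n, Y j mod int n)"
    then have c: "[X i = X j] (mod int n)" "[Y i = Y j] (mod int n)"
      by (auto simp: cong_def)
    have "coprime (3 * int h + 1) (int n)"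
    proof -
      have "4 * (3 * int h + 1) - 3 * int n = 1" using nz by simp
      then show ?thesis by (metis coprime_def dvd_diff dvd_mult)
    qed
    \<comment> \<open>Adding the coordinates cancels the coset index and leaves a multiple of
      \<open>i\<close>.\<close>
    moreover have "[(3 * int h + 1) * int i = (3 * int h + 1) * int j] (mod int n)"
      using cong_add[OF c] nz by (simp add: X_def Y_def algebra_simps)
    ultimately have m: "[int i = int j] (mod int n)"
      by (simp add: cong_mult_lcancel)
    then have "[(int h + 1) * int i = (int h + 1) * int j] (mod int n)"
      by (rule cong_scalar_left)
    from cong_diff[OF c(2) this] have "[int (R i) = int (R j)] (mod int n)"
      by (simp add: Y_def)
    \<comment> \<open>The cap in \<open>R\<close> keeps its values at most \<open>2 * k < n\<close>,
      so congruent values are equal.\<close>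
    then have R: "R i = R j" using n by (intro eq_if_cong_less[of _ _ n]) (auto simp: R_def)
    have mn: "i mod n = j mod n" using m by (metis cong_def cong_int_iff)
    show "i = j"
    proof (cases "R i < 2 * k")
      case True
      then have "i mod 2 + 2 * (i div 2 div n) = j mod 2 + 2 * (j div 2 div n)"
        using R by (auto simp: R_def min_def split: if_splits)
      moreover have "i mod 2 = j mod 2 \<and> q = r" if "i mod 2 + 2 * q = j mod 2 + 2 * r" for q r
        using that by presburger
      ultimately have par: "i mod 2 = j mod 2" and "i div 2 div n = j div 2 div n"
        by blast+
      then have d: "i div (2 * n) = j div (2 * n)" by (simp add: div_mult2_eq)
      \<comment> \<open>\<open>n\<close> is odd, so parity and residue modulo \<open>n\<close> fix
        the residue modulo \<open>2 * n\<close>, the length of a block serving one pair of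
        cosets.\<close>
      have "coprime 2 n" using n by simp
      with par mn have "i mod (2 * n) = j mod (2 * n)"
        by (metis cong_def coprime_cong_mult_nat)
      with d show ?thesis by (metis div_mult_mod_eq)
    next
      case False
      \<comment> \<open>At the cap all \<open>k\<close> pairs are used up, so \<open>i\<close> lies
        in the final block of \<open>n\<close> indices, the single leftover coset.\<close>
      have "i div n = 2 * k" if "i < n * n" "\<not> R i < 2 * k" for i
      proof -
        have "k \<le> i div 2 div n" using that(2) by (auto simp: R_def)
        then have "k * (2 * n) \<le> i"
          using n0 by (simp add: div_mult2_eq[symmetric] less_eq_div_iff_mult_less_eq)
        then have "2 * k \<le> i div n" using n0 by (simp add: less_eq_div_iff_mult_less_eq)
        moreover have "i div n < n" using that(1) by (rule less_mult_imp_div_less)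
        ultimately show ?thesis using n by simp
      qed
      then have "i div n = j div n" using False R ij by simp
      with mn show ?thesis by (metis div_mult_mod_eq)
    qed
  qed
  show ?thesis
  proof (rule rn_torus_le_if_ordering[where a = h and X = X and Y = Y, OF n _ inj])
    fix i assume "even i" "i + 1 < n * n"
    then show "2 * int k + 1 - int h \<le> cyc_norm n (X (i + 1) - X i) + cyc_norm n (Y (i + 1) - Y i)"
      using s1e[of i] nz by linarith
  next
    fix i
    show "int k + int h \<le> cyc_norm n (X (i + 1) - X i) + cyc_norm n (Y (i + 1) - Y i)"
      using s1o[of i] nz by linarith
  next
    fix i :: nat assume "even i"
    then show "int k - int h \<le> cyc_norm n (X (i + 3) - X i) + cyc_norm n (Y (i + 3) - Y i)"
      using s3e[of i] nz by linarith
  qed (use s2 s3o k in auto)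
qed

section \<open>The small cases and the conclusion\<close>

lemma rn_torus_5_le: "rn (torus 5) \<le> 1 + (2 + 1) * (5 * 5 div 2)"
proof -
  \<comment> \<open>Found by a depth-first search; the step \<open>(k - 1, k div 2 + 2)\<close> of the general
    even case is too short for \<open>k = 2\<close>.\<close>
  define ps :: "(int \<times> int) list" where
    "ps = [(0, 0), (2, 2), (0, 3), (2, 0), (0, 1), (2, 3), (0, 4), (3, 1), (0, 2), (3, 4),
      (1, 0), (3, 2), (1, 3), (3, 0), (4, 2), (2, 4), (1, 2), (4, 0), (2, 1), (4, 3),
      (1, 4), (4, 1), (3, 3), (1, 1), (4, 4)]"
  define X where "X i = fst (ps ! i)" for i
  define Y where "Y i = snd (ps ! i)" for i
  define dst where "dst i j = cyc_norm 5 (X j - X i) + cyc_norm 5 (Y j - Y i)" for i j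
  have "distinct (map (\<lambda>i. (X i mod int 5, Y i mod int 5)) [0..<25])"
    unfolding X_def Y_def ps_def by code_simp
  then have "inj_on (\<lambda>i. (X i mod int 5, Y i mod int 5)) {..<5 * 5}"
    by (simp add: distinct_map lessThan_atLeast0)
  then show ?thesis
  \<comment> \<open>\<open>rotated 2\<close> brings the injectivity premise to the front, to be
    discharged by the chained fact.\<close>
  proof (rule rn_torus_le_if_ordering[where a = 1 and X = X and Y = Y, rotated 2], fold dst_def)
    \<comment> \<open>With \<open>k = 2\<close> and \<open>a = 1\<close> the label gaps are 1 and 2,
      which fixes the bounds checked here by evaluation.\<close>
    have 1: "\<forall>i\<in>set [0..<24]. (if even i then 4 else 3) \<le> dst i (i + 1)"
      unfolding dst_def X_def Y_def ps_def by code_simp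
    have 2: "\<forall>i\<in>set [0..<23]. 2 \<le> dst i (i + 2)"
      unfolding dst_def X_def Y_def ps_def by code_simp
    have 3: "\<forall>i\<in>set [0..<22]. (if even i then 1 else 0) \<le> dst i (i + 3)"
      unfolding dst_def X_def Y_def ps_def by code_simp
    fix i :: nat
    show "2 * int 2 + 1 - int 1 \<le> dst i (i + 1)" if "i + 1 < 5 * 5" "even i"
      using bspec[OF 1, of i] that by simp
    show "int 2 + int 1 \<le> dst i (i + 1)" if "i + 1 < 5 * 5" "odd i"
      using bspec[OF 1, of i] that by simp
    show "int 2 \<le> dst i (i + 2)" if "i + 2 < 5 * 5"
      using bspec[OF 2, of i] that by simp
    show "int 2 - int 1 \<le> dst i (i + 3)" if "i + 3 < 5 * 5" "even i"
      using bspec[OF 3, of i] that by simp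
    show "int 1 - 1 \<le> dst i (i + 3)" if "i + 3 < 5 * 5" "odd i"
      using bspec[OF 3, of i] that by simp
  qed simp_all
qed

text \<open>Index 0 is the only one, so all distance conditions are vacuous. The bound stays
  unevaluated to match the conclusion of \<open>rn_torus_le_if_ordering\<close>.\<close>

lemma rn_torus_1_le: "rn (torus 1) \<le> 1 + (0 + 1) * (1 * 1 div 2)"
  by (rule rn_torus_le_if_ordering[where a = 0 and X = "\<lambda>_. 0" and Y = "\<lambda>_. 0"]) (auto simp: inj_on_def)

theorem theorem3p4:
  fixes k n :: nat
  assumes "n = 2 * k + 1"
  shows "real (rn (cycle_graph n \<box> cycle_graph n)) \<le> (real n ^ 2 - 1) / 2 * (real k + 1) + 1"
proof -
  have "rn (torus n) \<le> 1 + (k + 1) * (n * n div 2)"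
  proof -
    consider "k = 0" | h where "k = 2 * h + 1" | "k = 2" | h where "h \<ge> 2" "k = 2 * h"
      by (metis One_nat_def Suc_1 Suc_eq_plus1 less_2_cases mult_0_right mult_1_right not_less oddE evenE)
    then show ?thesis
    proof cases
      case 1
      then show ?thesis using rn_torus_1_le assms by simp
    next
      case 2
      then show ?thesis using assms by (rule rn_torus_le_odd)
    next
      case 3
      then show ?thesis using rn_torus_5_le assms by simp
    next
      case 4
      then show ?thesis using assms by (rule rn_torus_le_even)
    qed
  qed
  then have "real (rn (torus n)) \<le> real (1 + (k + 1) * (n * n div 2))"
    by (rule of_nat_mono)
  \<comment> \<open>\<open>n * n\<close> is odd, so the truncated quotient is exactly half of its
    predecessor.\<close>
  moreover have half: "real (n * n div 2) = (real n ^ 2 - 1) / 2"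
  proof -
    have "odd (n * n)" using assms by simp
    then have "n * n = 2 * (n * n div 2) + 1" by (metis odd_two_times_div_two_succ)
    then have "real n * real n = 2 * real (n * n div 2) + 1"
      by (metis of_nat_1 of_nat_add of_nat_mult of_nat_numeral)
    then show ?thesis by (simp add: power2_eq_square)
  qed
  then have "real (1 + (k + 1) * (n * n div 2)) = (real n ^ 2 - 1) / 2 * (real k + 1) + 1"
    by (simp only: of_nat_add of_nat_mult of_nat_1 mult.commute add.commute)
  ultimately show ?thesis by simp
qed

end
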